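(* Let $S,T$ be finite forests, i.e. objects of the category $\mathrm{F_{fin}}$ of finite forests and order-preserving open maps. Then $S\otimes T$ (ordered by $\preceq$, with the maps $\overline{\pi_1}:S\otimes T\to S$ and $\overline{\pi_2}:S\otimes T\to T$) is the product of $S$ and $T$ in $\mathrm{F_{fin}}$.
   Context: A finite forest is a finite poset $F$ such that $(x]=\{y\in F:y\le x\}$ is a chain for every $x\in F$. An order-preserving map $f:F\to G$ between forests is open if for all $x\in F$, $y\in G$ with $y\le f(x)$ there is $z\in F$ with $z\le x$ and $f(z)=y$. For a finite poset $F$, a $u$-succession of $F$ is a set $\{f_0,\dots,f_n\}$ of elements of $F$ with $f_0$ minimal in $F$ and $f_0<\dots<f_n$; $\mathrm{US}(F)$ is the set of $u$-successions. For $f=\{f_0<\dots<f_n\}$ and $g=\{g_0<\dots<g_m\}$ in $\mathrm{US}(F)$, $f\preceq g$ iff $n\le m$ and $f_i=g_i$ for $i=0,\dots,n$. $S\times T$ is the product poset with coordinate projections $\pi_1,\pi_2$. For $p=\{p_0<\dots<p_k\}\in\mathrm{US}(S\times T)$ put $\hat{\pi}_j(p)=\{\pi_j(p_0),\dots,\pi_j(p_k)\}$, $j=1,2$. Then $$S\otimes T=\{p=\{p_0<\dots<p_k\}\in\mathrm{US}(S\times T):\hat\pi_1(p)=(\pi_1(p_k)]\text{ and }\hat\pi_2(p)=(\pi_2(p_k)]\},$$ ordered by $\preceq$, and $\overline{\pi_j}(p)=\max\hat\pi_j(p)$. *)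

theory Defs
  imports Main "HOL-Library.FuncSet"
begin

text \<open>A poset is given by its reflexive order relation \<open>F\<close>; its underlying set is \<open>Field F\<close>,
  and \<open>under F x\<close> is the principal down-set $(x]$.\<close>

definition finite_forest :: "'a rel \<Rightarrow> bool" where
  "finite_forest F \<longleftrightarrow>
     finite (Field F) \<and> Partial_order F \<and> (\<forall>x\<in>Field F. under F x \<in> Chains F)"

definition open_map :: "'a rel \<Rightarrow> 'b rel \<Rightarrow> ('a \<Rightarrow> 'b) \<Rightarrow> bool" where
  "open_map F G f \<longleftrightarrow>
     (\<forall>x\<in>Field F. \<forall>y\<in>Field G. (y, f x) \<in> G \<longrightarrow> (\<exists>z\<in>Field F. (z, x) \<in> F \<and> f z = y))"

definition forest_morphism :: "'a rel \<Rightarrow> 'b rel \<Rightarrow> ('a \<Rightarrow> 'b) \<Rightarrow> bool" where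
  "forest_morphism F G f \<longleftrightarrow>
     f \<in> Field F \<rightarrow> Field G \<and>
     monotone_on (Field F) (\<lambda>x y. (x, y) \<in> F) (\<lambda>x y. (x, y) \<in> G) f \<and>
     open_map F G f"

text \<open>The categorical product in the category of finite forests and order-preserving open maps.
  Maps out of \<open>F\<close> matter only on \<open>Field F\<close>, so equality of morphisms is equality there.
  HOL cannot quantify over types inside a formula, so the type of the elements of the test
  forests is a parameter; a theorem with a free \<open>TYPE('c)\<close> covers all test forests.\<close>

definition is_forest_product ::
  "'c itself \<Rightarrow> 'a rel \<Rightarrow> 'b rel \<Rightarrow> 'p rel \<Rightarrow> ('p \<Rightarrow> 'a) \<Rightarrow> ('p \<Rightarrow> 'b) \<Rightarrow> bool" where
  "is_forest_product TYPE('c) S T P p\<^sub>1 p\<^sub>2 \<longleftrightarrow>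
     finite_forest P \<and> forest_morphism P S p\<^sub>1 \<and> forest_morphism P T p\<^sub>2 \<and>
     (\<forall>(H :: 'c rel) f g.
        finite_forest H \<longrightarrow> forest_morphism H S f \<longrightarrow> forest_morphism H T g \<longrightarrow>
        (\<exists>h. (forest_morphism H P h \<and>
               (\<forall>x\<in>Field H. p\<^sub>1 (h x) = f x) \<and> (\<forall>x\<in>Field H. p\<^sub>2 (h x) = g x)) \<and>
             (\<forall>h'. forest_morphism H P h' \<and>
               (\<forall>x\<in>Field H. p\<^sub>1 (h' x) = f x) \<and> (\<forall>x\<in>Field H. p\<^sub>2 (h' x) = g x) \<longrightarrow>
               (\<forall>x\<in>Field H. h' x = h x))))"

definition prod_poset :: "'a rel \<Rightarrow> 'b rel \<Rightarrow> ('a \<times> 'b) rel" where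
  "prod_poset S T = {((s, t), (s', t')). (s, s') \<in> S \<and> (t, t') \<in> T}"

definition minimal_in :: "'a rel \<Rightarrow> 'a \<Rightarrow> bool" where
  "minimal_in F x \<longleftrightarrow> x \<in> Field F \<and> (\<forall>y\<in>Field F. (y, x) \<in> F \<longrightarrow> y = x)"

text \<open>\<open>enumerates F xs p\<close>: the list \<open>xs\<close> is $[p_0, \ldots, p_k]$ for the u-succession
  $p = \{p_0 < \cdots < p_k\}$ of \<open>F\<close>, so that $k$ is \<open>length xs - 1\<close> and $p_k$ is \<open>last xs\<close>.
  Such a list is determined by \<open>p\<close> when \<open>F\<close> is a partial order.\<close>

definition enumerates :: "'a rel \<Rightarrow> 'a list \<Rightarrow> 'a set \<Rightarrow> bool" where
  "enumerates F xs p \<longleftrightarrow>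
     xs \<noteq> [] \<and> set xs = p \<and> p \<subseteq> Field F \<and> minimal_in F (hd xs) \<and>
     sorted_wrt (\<lambda>x y. (x, y) \<in> F \<and> x \<noteq> y) xs"

definition US :: "'a rel \<Rightarrow> 'a set set" where
  "US F = {p. \<exists>xs. enumerates F xs p}"

definition US_le :: "'a rel \<Rightarrow> 'a set \<Rightarrow> 'a set \<Rightarrow> bool" where
  "US_le F p q \<longleftrightarrow>
     (\<exists>xs ys. enumerates F xs p \<and> enumerates F ys q \<and>
        length xs \<le> length ys \<and> (\<forall>i<length xs. xs ! i = ys ! i))"

definition tensor_carrier :: "'a rel \<Rightarrow> 'b rel \<Rightarrow> ('a \<times> 'b) set set" where
  "tensor_carrier S T =
     {p \<in> US (prod_poset S T). \<exists>xs. enumerates (prod_poset S T) xs p \<and>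
        fst ` p = under S (fst (last xs)) \<and> snd ` p = under T (snd (last xs))}"

definition tensor :: "'a rel \<Rightarrow> 'b rel \<Rightarrow> ('a \<times> 'b) set rel" where
  "tensor S T =
     {(p, q). p \<in> tensor_carrier S T \<and> q \<in> tensor_carrier S T \<and> US_le (prod_poset S T) p q}"

lemma Field_tensor: "Field (tensor S T) = tensor_carrier S T"
proof
  show "Field (tensor S T) \<subseteq> tensor_carrier S T"
    by (auto simp: Field_def tensor_def)
  show "tensor_carrier S T \<subseteq> Field (tensor S T)"
  proof
    fix p assume p: "p \<in> tensor_carrier S T"
    then have "US_le (prod_poset S T) p p"
      by (auto simp: tensor_carrier_def US_le_def)
    with p have "(p, p) \<in> tensor S T" by (simp add: tensor_def)
    then show "p \<in> Field (tensor S T)" by (rule FieldI1)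
  qed
qed

definition max_in :: "'a rel \<Rightarrow> 'a set \<Rightarrow> 'a" where
  "max_in F A = (THE m. m \<in> A \<and> (\<forall>x\<in>A. (x, m) \<in> F))"

definition proj1_bar :: "'a rel \<Rightarrow> ('a \<times> 'b) set \<Rightarrow> 'a" where
  "proj1_bar S p = max_in S (fst ` p)"

definition proj2_bar :: "'b rel \<Rightarrow> ('a \<times> 'b) set \<Rightarrow> 'b" where
  "proj2_bar T p = max_in T (snd ` p)"

end

theory Submission
  imports Defs
begin

text \<open>Proof idea. A member of \<open>tensor_carrier S T\<close> is a finite chain \<open>p\<close> of \<open>S \<times> T\<close> with a
  greatest element \<open>m\<close> whose two projections are the full principal down-sets below the components
  of \<open>m\<close>. That the least element of \<open>p\<close> is minimal follows: its components are least in
  principal down-sets. The relation \<open>\<preceq>\<close> says that one such chain is a truncation of the other,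
  that is, consists of its elements below some chosen \<open>m\<close>, and every truncation of a member is again
  a member (\<open>full_chain_truncate\<close>, \<open>tensor_iff\<close>). Hence the elements below \<open>q\<close> correspond to the
  elements of the chain \<open>q\<close>, which makes \<open>S \<otimes> T\<close> a forest. The two maps to \<open>S\<close> and \<open>T\<close>
  return the components of the top. They are open because every element below such a component
  is the component of some \<open>m \<in> q\<close>, which is the top of the truncation of \<open>q\<close> at \<open>m\<close>.

  For morphisms \<open>f : H \<rightarrow> S\<close> and \<open>g : H \<rightarrow> T\<close> the mediating map sends \<open>x\<close> to the image of
  the chain \<open>under H x\<close> under \<open>z \<mapsto> (f z, g z)\<close>. Monotonicity and openness of \<open>f\<close> and
  \<open>g\<close> give exactly the condition on the projections of this image,
  and its truncation at \<open>(f z, g z)\<close> is the image of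
  \<open>under H z\<close> (\<open>mediating_truncate\<close>). It is unique because any mediating \<open>h'\<close> has \<open>(f x, g x)\<close> as
  top of \<open>h' x\<close>: by openness each element of \<open>h' x\<close> is the top of some \<open>h' z\<close> with
  \<open>z \<le> x\<close>, and by monotonicity each such top lies in \<open>h' x\<close>.\<close>

section \<open>Forests, chains and their enumerations\<close>

lemma finite_forestD:
  assumes "finite_forest F"
  shows finite_forest_finite: "finite (Field F)"
    and finite_forest_refl: "x \<in> Field F \<Longrightarrow> (x, x) \<in> F"
    and finite_forest_trans: "(x, y) \<in> F \<Longrightarrow> (y, z) \<in> F \<Longrightarrow> (x, z) \<in> F"
    and finite_forest_antisym: "(x, y) \<in> F \<Longrightarrow> (y, x) \<in> F \<Longrightarrow> x = y"
    and finite_forest_linear: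
      "(y, x) \<in> F \<Longrightarrow> (z, x) \<in> F \<Longrightarrow> (y, z) \<in> F \<or> (z, y) \<in> F"
proof -
  have po: "Partial_order F" and fin: "finite (Field F)"
    and ch: "\<forall>x\<in>Field F. under F x \<in> Chains F"
    using assms by (auto simp: finite_forest_def)
  show "finite (Field F)" by (rule fin)
  show "x \<in> Field F \<Longrightarrow> (x, x) \<in> F"
    using po by (auto simp: partial_order_on_def preorder_on_def refl_on_def)
  show "(x, y) \<in> F \<Longrightarrow> (y, z) \<in> F \<Longrightarrow> (x, z) \<in> F"
    using po by (auto simp: partial_order_on_def preorder_on_def dest: transD)
  show "(x, y) \<in> F \<Longrightarrow> (y, x) \<in> F \<Longrightarrow> x = y"
    using po by (auto simp: partial_order_on_def dest: antisymD)
  show "(y, x) \<in> F \<Longrightarrow> (z, x) \<in> F \<Longrightarrow> (y, z) \<in> F \<or> (z, y) \<in> F"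
    using ch FieldI2[of y x F] by (fastforce simp: Chains_def under_def)
qed

lemma finite_forestI:
  assumes "finite (Field F)"
    and "\<And>x. x \<in> Field F \<Longrightarrow> (x, x) \<in> F"
    and "\<And>x y z. (x, y) \<in> F \<Longrightarrow> (y, z) \<in> F \<Longrightarrow> (x, z) \<in> F"
    and "\<And>x y. (x, y) \<in> F \<Longrightarrow> (y, x) \<in> F \<Longrightarrow> x = y"
    and "\<And>x y z. (y, x) \<in> F \<Longrightarrow> (z, x) \<in> F \<Longrightarrow> (y, z) \<in> F \<or> (z, y) \<in> F"
  shows "finite_forest F"
proof -
  have "refl_on (Field F) F" using assms(2) by (auto simp: refl_on_def)
  moreover have "F \<subseteq> Field F \<times> Field F" by (auto simp: Field_def)
  moreover have "trans F" using assms(3) by (rule transI)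
  moreover have "antisym F" using assms(4) by (rule antisymI)
  ultimately show ?thesis
    using assms(1,5)
    by (auto simp: finite_forest_def partial_order_on_def preorder_on_def Chains_def under_def)
qed

lemma forest_morphismD:
  assumes "forest_morphism F G f"
  shows forest_morphism_Field: "x \<in> Field F \<Longrightarrow> f x \<in> Field G"
    and forest_morphism_mono: "(x, y) \<in> F \<Longrightarrow> (f x, f y) \<in> G"
    and forest_morphism_open:
      "x \<in> Field F \<Longrightarrow> (u, f x) \<in> G \<Longrightarrow> \<exists>z. (z, x) \<in> F \<and> f z = u"
proof -
  show "x \<in> Field F \<Longrightarrow> f x \<in> Field G"
    using assms by (auto simp: forest_morphism_def)
  show "(x, y) \<in> F \<Longrightarrow> (f x, f y) \<in> G"
    using assms FieldI1[of x y F] FieldI2[of x y F]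
    by (auto simp: forest_morphism_def monotone_on_def)
  show "x \<in> Field F \<Longrightarrow> (u, f x) \<in> G \<Longrightarrow> \<exists>z. (z, x) \<in> F \<and> f z = u"
    using assms unfolding forest_morphism_def open_map_def by (meson FieldI1)
qed

lemma forest_morphismI:
  assumes "\<And>x. x \<in> Field F \<Longrightarrow> f x \<in> Field G"
    and "\<And>x y. (x, y) \<in> F \<Longrightarrow> (f x, f y) \<in> G"
    and "\<And>x u. x \<in> Field F \<Longrightarrow> (u, f x) \<in> G \<Longrightarrow> \<exists>z. (z, x) \<in> F \<and> f z = u"
  shows "forest_morphism F G f"
  using assms unfolding forest_morphism_def open_map_def monotone_on_def
  by (auto simp: Pi_iff) (meson FieldI1)

text \<open>For a morphism, openness and monotonicity together say that down-sets go onto down-sets.\<close>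

lemma forest_morphism_image_under:
  assumes "forest_morphism F G f" and "x \<in> Field F"
  shows "f ` under F x = under G (f x)"
  using forest_morphism_mono[OF assms(1)] forest_morphism_open[OF assms]
  by (fastforce simp: under_def)

lemma finite_chain_has_greatest:
  assumes "finite p" "p \<noteq> {}" "p \<in> Chains R" "trans R"
  shows "\<exists>m\<in>p. \<forall>x\<in>p. (x, m) \<in> R"
  using assms(1-3)
proof (induction p rule: finite_ne_induct)
  case (singleton x)
  then show ?case by (auto simp: Chains_def)
next
  case (insert x p)
  then obtain m where m: "m \<in> p" "\<forall>y\<in>p. (y, m) \<in> R" by (auto simp: Chains_def)
  have "(x, x) \<in> R" "(x, m) \<in> R \<or> (m, x) \<in> R"
    using insert.prems m(1) by (auto simp: Chains_def)
  then show ?case using m \<open>trans R\<close> by (blast dest: transD)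
qed

lemma finite_chain_sorted_list:
  assumes "finite p" "p \<in> Chains R" "trans R"
  shows "\<exists>xs. set xs = p \<and> sorted_wrt (\<lambda>x y. (x, y) \<in> R \<and> x \<noteq> y) xs"
  using assms(1,2)
proof (induction "card p" arbitrary: p)
  case 0
  then show ?case by (intro exI[of _ "[]"]) auto
next
  case (Suc n)
  then have "p \<noteq> {}" by auto
  then obtain m where m: "m \<in> p" "\<forall>x\<in>p. (x, m) \<in> R"
    using finite_chain_has_greatest Suc.prems \<open>trans R\<close> by blast
  have "n = card (p - {m})" "finite (p - {m})" "p - {m} \<in> Chains R"
    using Suc m by (auto simp: Chains_def)
  from Suc.hyps(1)[OF this] obtain xs where
    xs: "set xs = p - {m}" "sorted_wrt (\<lambda>x y. (x, y) \<in> R \<and> x \<noteq> y) xs" by blast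
  then show ?case
    using m by (intro exI[of _ "xs @ [m]"]) (auto simp: sorted_wrt_append)
qed

section \<open>The tensor product as full chains ordered by truncation\<close>

text \<open>Carrying the top \<open>m\<close> as an argument replaces the enumerating list: by
  \<open>tensor_carrier_iff\<close> the members of the tensor product are the sets with such a top.\<close>

definition full_chain :: "'a rel \<Rightarrow> 'b rel \<Rightarrow> ('a \<times> 'b) set \<Rightarrow> 'a \<times> 'b \<Rightarrow> bool" where
  "full_chain S T p m \<longleftrightarrow>
     p \<in> Chains (prod_poset S T) \<and> m \<in> p \<and> (\<forall>x\<in>p. (x, m) \<in> prod_poset S T) \<and>
     fst ` p = under S (fst m) \<and> snd ` p = under T (snd m)"

definition truncate :: "'a rel \<Rightarrow> 'a set \<Rightarrow> 'a \<Rightarrow> 'a set" where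
  "truncate R p m = {x \<in> p. (x, m) \<in> R}"

locale forest_pair =
  fixes S :: "'a rel" and T :: "'b rel"
  assumes S: "finite_forest S" and T: "finite_forest T"
begin

abbreviation R :: "('a \<times> 'b) rel" where "R \<equiv> prod_poset S T"

lemma R_trans: "(x, y) \<in> R \<Longrightarrow> (y, z) \<in> R \<Longrightarrow> (x, z) \<in> R"
  using finite_forest_trans[OF S] finite_forest_trans[OF T]
  by (auto simp: prod_poset_def)

lemma trans_R: "trans R"
  using R_trans by (rule transI)

lemma R_antisym: "(x, y) \<in> R \<Longrightarrow> (y, x) \<in> R \<Longrightarrow> x = y"
  using finite_forest_antisym[OF S] finite_forest_antisym[OF T]
  by (auto simp: prod_poset_def)

lemma Field_R: "Field R \<subseteq> Field S \<times> Field T"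
  by (auto simp: prod_poset_def Field_def)

lemma R_refl: "x \<in> Field R \<Longrightarrow> (x, x) \<in> R"
  using Field_R finite_forest_refl[OF S] finite_forest_refl[OF T]
  by (cases x) (auto simp: prod_poset_def)

lemma finite_Field_R: "finite (Field R)"
  using finite_subset[OF Field_R] finite_forest_finite[OF S] finite_forest_finite[OF T] by blast

lemma chain_subset_Field: "p \<in> Chains R \<Longrightarrow> p \<subseteq> Field R"
  by (auto simp: Chains_def Field_def)

lemma enumerates_chain:
  assumes "enumerates R xs p"
  shows "p \<in> Chains R"
proof -
  have "(x, y) \<in> R \<or> (y, x) \<in> R" if "x \<in> p" "y \<in> p" for x y
  proof -
    have p: "set xs = p" "p \<subseteq> Field R"
      and sorted: "sorted_wrt (\<lambda>x y. (x, y) \<in> R \<and> x \<noteq> y) xs"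
      using assms by (auto simp: enumerates_def)
    have "x \<in> set xs" "y \<in> set xs" using that p by simp_all
    then obtain i j where ij: "i < length xs" "j < length xs" "x = xs ! i" "y = xs ! j"
      unfolding in_set_conv_nth by blast
    show ?thesis
    proof (cases i j rule: linorder_cases)
      case less
      then show ?thesis using sorted_wrt_nth_less[OF sorted, of i j] ij by simp
    next
      case equal
      then show ?thesis using R_refl p(2) that(1) ij by blast
    next
      case greater
      then show ?thesis using sorted_wrt_nth_less[OF sorted, of j i] ij by simp
    qed
  qed
  then show ?thesis by (auto simp: Chains_def)
qed

lemma enumerates_last:
  assumes "enumerates R xs p"
  shows "last xs \<in> p" and "x \<in> p \<Longrightarrow> (x, last xs) \<in> R"
proof -
  have ne: "xs \<noteq> []" and p: "set xs = p" "p \<subseteq> Field R"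
    and sorted: "sorted_wrt (\<lambda>x y. (x, y) \<in> R \<and> x \<noteq> y) xs"
    using assms by (auto simp: enumerates_def)
  show "last xs \<in> p" using ne p by auto
  then have "(last xs, last xs) \<in> R" using p R_refl by blast
  moreover have "sorted_wrt (\<lambda>x y. (x, y) \<in> R \<and> x \<noteq> y) (butlast xs @ [last xs])"
    using sorted ne by simp
  then have "\<forall>x\<in>set (butlast xs). (x, last xs) \<in> R"
    by (simp only: sorted_wrt_append) auto
  moreover have "set xs = insert (last xs) (set (butlast xs))"
    using arg_cong[OF append_butlast_last_id[OF ne], of set] by simp
  ultimately show "x \<in> p \<Longrightarrow> (x, last xs) \<in> R" using p by auto
qed

text \<open>Minimality of the first element comes for free: anything below it has components in the
  projections of the chain, and the first element is below all elements of the chain.\<close>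

lemma full_chain_enumerates:
  assumes "full_chain S T p m"
  shows "\<exists>xs. enumerates R xs p \<and> last xs = m"
proof -
  have chain: "p \<in> Chains R" and m: "m \<in> p" "\<forall>x\<in>p. (x, m) \<in> R"
    and proj: "fst ` p = under S (fst m)" "snd ` p = under T (snd m)"
    using assms by (auto simp: full_chain_def)
  have p: "p \<subseteq> Field R" by (rule chain_subset_Field[OF chain])
  then have "finite p" using finite_Field_R by (rule finite_subset)
  then obtain xs where xs: "set xs = p"
    and sorted: "sorted_wrt (\<lambda>x y. (x, y) \<in> R \<and> x \<noteq> y) xs"
    using finite_chain_sorted_list[OF _ chain trans_R] by blast
  have ne: "xs \<noteq> []" using xs m by auto
  then have hd: "hd xs \<in> p" using xs by auto
  have hd_le: "(hd xs, x) \<in> R" if "x \<in> p" for x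
  proof -
    have "sorted_wrt (\<lambda>x y. (x, y) \<in> R \<and> x \<noteq> y) (hd xs # tl xs)"
      using sorted ne by simp
    then have "\<forall>x\<in>set (tl xs). (hd xs, x) \<in> R" by (simp only: sorted_wrt.simps) auto
    moreover have "x = hd xs \<or> x \<in> set (tl xs)"
      using that ne xs by (metis list.collapse set_ConsD)
    ultimately show ?thesis using R_refl p hd by blast
  qed
  have "minimal_in R (hd xs)"
    unfolding minimal_in_def
  proof (intro conjI ballI impI)
    show "hd xs \<in> Field R" using hd p by blast
    fix y assume y: "(y, hd xs) \<in> R"
    then have "(y, m) \<in> R" using m hd R_trans by blast
    then have "fst y \<in> fst ` p" "snd y \<in> snd ` p"
      unfolding proj by (auto simp: under_def prod_poset_def)
    then obtain u v where "u \<in> p" "fst u = fst y" "v \<in> p" "snd v = snd y"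
      by (auto simp: image_iff)
    then have "(hd xs, y) \<in> R"
      using hd_le[of u] hd_le[of v] by (auto simp: prod_poset_def)
    then show "y = hd xs" using y R_antisym by blast
  qed
  then have enum: "enumerates R xs p"
    using ne xs p sorted by (simp add: enumerates_def)
  then have "last xs = m"
    using enumerates_last[OF enum] m R_antisym by blast
  then show ?thesis using enum by blast
qed

lemma tensor_carrier_iff: "p \<in> tensor_carrier S T \<longleftrightarrow> (\<exists>m. full_chain S T p m)"
proof
  assume "p \<in> tensor_carrier S T"
  then obtain xs where xs: "enumerates R xs p"
    and "fst ` p = under S (fst (last xs))" "snd ` p = under T (snd (last xs))"
    by (auto simp: tensor_carrier_def)
  then have "full_chain S T p (last xs)"
    using enumerates_chain enumerates_last[OF xs] by (auto simp: full_chain_def)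
  then show "\<exists>m. full_chain S T p m" ..
next
  assume "\<exists>m. full_chain S T p m"
  then obtain m where m: "full_chain S T p m" ..
  then obtain xs where "enumerates R xs p" "last xs = m"
    using full_chain_enumerates by blast
  then show "p \<in> tensor_carrier S T"
    using m by (auto simp: tensor_carrier_def US_def full_chain_def)
qed

text \<open>The projections stay full: an element of \<open>q\<close> that is not below \<open>m\<close> lies above \<open>m\<close>, so if
  one of its components is below that of \<open>m\<close> then these components coincide, and \<open>m\<close> itself
  realises this component.\<close>

lemma full_chain_truncate:
  assumes q: "full_chain S T q n" and m: "m \<in> q"
  shows "full_chain S T (truncate R q m) m"
proof -
  have chain: "\<And>x y. x \<in> q \<Longrightarrow> y \<in> q \<Longrightarrow> (x, y) \<in> R \<or> (y, x) \<in> R"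
    using q by (auto simp: full_chain_def Chains_def)
  have mn: "(m, n) \<in> R" and mm: "(m, m) \<in> R"
    using q m chain[of m m] by (auto simp: full_chain_def)
  have "under S (fst m) \<subseteq> fst ` truncate R q m"
  proof
    fix a assume a: "a \<in> under S (fst m)"
    then have "a \<in> under S (fst n)"
      using mn finite_forest_trans[OF S] by (auto simp: under_def prod_poset_def)
    also have "under S (fst n) = fst ` q" using q by (simp add: full_chain_def)
    finally obtain y where y: "y \<in> q" "fst y = a" by blast
    show "a \<in> fst ` truncate R q m"
    proof (cases "(y, m) \<in> R")
      case True
      then show ?thesis using y by (auto simp: truncate_def)
    next
      case False
      then have "(fst m, a) \<in> S" using chain[OF m y(1)] y by (auto simp: prod_poset_def)
      then have "a = fst m" using a finite_forest_antisym[OF S] by (auto simp: under_def)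
      then show ?thesis using m mm by (auto simp: truncate_def)
    qed
  qed
  moreover have "under T (snd m) \<subseteq> snd ` truncate R q m"
  proof
    fix b assume b: "b \<in> under T (snd m)"
    then have "b \<in> under T (snd n)"
      using mn finite_forest_trans[OF T] by (auto simp: under_def prod_poset_def)
    also have "under T (snd n) = snd ` q" using q by (simp add: full_chain_def)
    finally obtain y where y: "y \<in> q" "snd y = b" by blast
    show "b \<in> snd ` truncate R q m"
    proof (cases "(y, m) \<in> R")
      case True
      then show ?thesis using y by (auto simp: truncate_def)
    next
      case False
      then have "(snd m, b) \<in> T" using chain[OF m y(1)] y by (auto simp: prod_poset_def)
      then have "b = snd m" using b finite_forest_antisym[OF T] by (auto simp: under_def)
      then show ?thesis using m mm by (auto simp: truncate_def)
    qed
  qed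
  moreover have "fst ` truncate R q m \<subseteq> under S (fst m)" "snd ` truncate R q m \<subseteq> under T (snd m)"
    by (auto simp: truncate_def under_def prod_poset_def)
  moreover have "truncate R q m \<in> Chains R"
    using chain by (auto simp: truncate_def Chains_def)
  ultimately show ?thesis using m mm by (auto simp: full_chain_def truncate_def)
qed

lemma full_chain_top_unique: "full_chain S T p m \<Longrightarrow> full_chain S T p n \<Longrightarrow> m = n"
  using R_antisym by (auto simp: full_chain_def)

lemma full_chain_eq_truncate: "full_chain S T p m \<Longrightarrow> p = truncate R p m"
  by (auto simp: full_chain_def truncate_def)

lemma truncate_truncate:
  assumes "(m, n) \<in> R"
  shows "truncate R (truncate R p n) m = truncate R p m"
  using R_trans[OF _ assms] by (auto simp: truncate_def)

text \<open>In a strictly increasing list nothing after the prefix \<open>p\<close> can lie below an element of the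
  prefix, so \<open>p\<close> consists of all elements of \<open>q\<close> below the top of \<open>p\<close>.\<close>

lemma US_le_full_chain_imp_truncate:
  assumes p: "full_chain S T p m" and le: "US_le R p q"
  shows "m \<in> q" and "p = truncate R q m"
proof -
  obtain xs ys where xs: "enumerates R xs p" and ys: "enumerates R ys q"
    and len: "length xs \<le> length ys" and nth: "\<forall>i<length xs. xs ! i = ys ! i"
    using le by (auto simp: US_le_def)
  have set: "set xs = p" "set ys = q" and sorted: "sorted_wrt (\<lambda>x y. (x, y) \<in> R \<and> x \<noteq> y) ys"
    using xs ys by (auto simp: enumerates_def)
  have sub: "p \<subseteq> q"
    using set len nth by (metis in_set_conv_nth order_less_le_trans subsetI)
  then show m: "m \<in> q" using p by (auto simp: full_chain_def)
  have "y \<in> p" if y: "y \<in> q" "(y, m) \<in> R" for y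
  proof -
    obtain j where j: "j < length ys" "y = ys ! j" using y set by (metis in_set_conv_nth)
    have "m \<in> set xs" using p set by (auto simp: full_chain_def)
    then obtain i where i: "i < length xs" "m = ys ! i" using nth by (metis in_set_conv_nth)
    have "\<not> i < j"
      using sorted_wrt_nth_less[OF sorted, of i j] R_antisym y i j by blast
    then have "j < length xs" using i by simp
    then show ?thesis using nth j set by (metis nth_mem)
  qed
  then show "p = truncate R q m"
    using sub p by (auto simp: truncate_def full_chain_def)
qed

lemma US_le_truncate:
  assumes q: "full_chain S T q n" and m: "m \<in> q"
  shows "US_le R (truncate R q m) q"
proof -
  obtain ys where ys: "enumerates R ys q" using full_chain_enumerates[OF q] by blast
  have set: "set ys = q" "ys \<noteq> []" "q \<subseteq> Field R" "minimal_in R (hd ys)"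
    and sorted: "sorted_wrt (\<lambda>x y. (x, y) \<in> R \<and> x \<noteq> y) ys"
    using ys by (auto simp: enumerates_def)
  obtain i where i: "i < length ys" "m = ys ! i" using m set by (metis in_set_conv_nth)
  let ?xs = "take (Suc i) ys"
  have le: "(ys ! j, m) \<in> R \<longleftrightarrow> j \<le> i" if "j < length ys" for j
  proof (cases j i rule: linorder_cases)
    case less
    then show ?thesis using sorted_wrt_nth_less[OF sorted, of j i] i by auto
  next
    case equal
    then show ?thesis using i m set R_refl[of m] by auto
  next
    case greater
    then show ?thesis using sorted_wrt_nth_less[OF sorted, of i j] i that
        R_antisym[of "ys ! i" "ys ! j"] by auto
  qed
  have "truncate R q m = set ?xs"
  proof (rule set_eqI)
    fix y
    have "y \<in> truncate R q m \<longleftrightarrow> (\<exists>j<length ys. y = ys ! j \<and> j \<le> i)"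
      using le unfolding truncate_def set(1)[symmetric] mem_Collect_eq in_set_conv_nth by metis
    also have "\<dots> \<longleftrightarrow> y \<in> set ?xs"
    proof
      assume "\<exists>j<length ys. y = ys ! j \<and> j \<le> i"
      then obtain j where "j < length ys" "y = ys ! j" "j \<le> i" by blast
      then have "j < length ?xs" "?xs ! j = y" by auto
      then show "y \<in> set ?xs" by (metis nth_mem)
    next
      assume "y \<in> set ?xs"
      then obtain j where "j < length ?xs" "?xs ! j = y" by (metis in_set_conv_nth)
      then show "\<exists>j<length ys. y = ys ! j \<and> j \<le> i" by auto
    qed
    finally show "y \<in> truncate R q m \<longleftrightarrow> y \<in> set ?xs" .
  qed
  moreover have "truncate R q m \<subseteq> Field R" using set by (auto simp: truncate_def)
  ultimately have "enumerates R ?xs (truncate R q m)"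
    using set sorted sorted_wrt_take[OF sorted, of "Suc i"]
    by (simp add: enumerates_def)
  then show ?thesis using ys i unfolding US_le_def
    by (intro exI[of _ ?xs] exI[of _ ys]) auto
qed

text \<open>Every later fact about the order goes through this description by truncation, which
  involves no enumerating lists.\<close>

lemma tensor_iff:
  assumes p: "full_chain S T p m"
  shows "(p, q) \<in> tensor S T \<longleftrightarrow> (\<exists>n. full_chain S T q n) \<and> m \<in> q \<and> p = truncate R q m"
  unfolding tensor_def mem_Collect_eq case_prod_conv tensor_carrier_iff
  using US_le_full_chain_imp_truncate[OF p] US_le_truncate p by blast

lemma tensorE:
  assumes "(p, q) \<in> tensor S T"
  obtains m n where "full_chain S T p m" "full_chain S T q n" "m \<in> q" "p = truncate R q m"
  using assms tensor_iff by (metis FieldI1 Field_tensor tensor_carrier_iff)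

lemma truncate_tensor:
  assumes "full_chain S T q n" and "m \<in> q"
  shows "(truncate R q m, q) \<in> tensor S T"
  using tensor_iff[OF full_chain_truncate[OF assms]] assms by blast

lemma full_chain_in_Field: "full_chain S T p m \<Longrightarrow> p \<in> Field (tensor S T)"
  unfolding Field_tensor tensor_carrier_iff by blast

section \<open>The tensor product is a forest and its projections are morphisms\<close>

lemma finite_forest_tensor: "finite_forest (tensor S T)"
proof (rule finite_forestI)
  have "Field (tensor S T) \<subseteq> Pow (Field R)"
    using chain_subset_Field tensor_carrier_iff unfolding Field_tensor full_chain_def by blast
  then show "finite (Field (tensor S T))"
    using finite_Field_R by (meson finite_Pow_iff finite_subset)
next
  fix p assume "p \<in> Field (tensor S T)"
  then obtain m where m: "full_chain S T p m" unfolding Field_tensor tensor_carrier_iff ..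
  then show "(p, p) \<in> tensor S T"
    using tensor_iff[OF m] full_chain_eq_truncate[OF m] unfolding full_chain_def by blast
next
  fix p q r assume pq: "(p, q) \<in> tensor S T" and qr: "(q, r) \<in> tensor S T"
  obtain m where m: "full_chain S T p m" "m \<in> q" "p = truncate R q m"
    using pq by (rule tensorE)
  obtain n k where n: "full_chain S T q n" "full_chain S T r k" "q = truncate R r n"
    using qr by (rule tensorE)
  have "m \<in> r" "(m, n) \<in> R" using m(2) n(3) by (auto simp: truncate_def)
  moreover from this have "p = truncate R r m" using m n truncate_truncate by simp
  ultimately show "(p, r) \<in> tensor S T" using tensor_iff[OF m(1)] n by blast
next
  have "p \<subseteq> q" if "(p, q) \<in> tensor S T" for p q
    using that by (rule tensorE) (auto simp: truncate_def)
  then show "(p, q) \<in> tensor S T \<Longrightarrow> (q, p) \<in> tensor S T \<Longrightarrow> p = q" for p q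
    by (meson subset_antisym)
next
  \<comment> \<open>Two truncations of one chain are nested in the order of their tops.\<close>
  fix p q r assume qp: "(q, p) \<in> tensor S T" and rp: "(r, p) \<in> tensor S T"
  obtain m k where m: "full_chain S T q m" "m \<in> p" "q = truncate R p m"
    and p: "full_chain S T p k"
    using qp by (rule tensorE)
  obtain n where n: "full_chain S T r n" "n \<in> p" "r = truncate R p n"
    using rp by (rule tensorE)
  have sub: "(truncate R p a, truncate R p b) \<in> tensor S T"
    if "(a, b) \<in> R" "a \<in> p" "full_chain S T (truncate R p b) b" for a b
    using truncate_tensor[OF that(3), of a] truncate_truncate[OF that(1)] that
    by (simp add: truncate_def)
  have "(m, n) \<in> R \<or> (n, m) \<in> R" using p m n by (auto simp: full_chain_def Chains_def)
  then show "(q, r) \<in> tensor S T \<or> (r, q) \<in> tensor S T"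
    using sub m n by metis
qed

lemma proj1_bar_eq:
  assumes "full_chain S T p m"
  shows "proj1_bar S p = fst m"
  unfolding proj1_bar_def max_in_def
proof (rule the_equality)
  show top: "fst m \<in> fst ` p \<and> (\<forall>x\<in>fst ` p. (x, fst m) \<in> S)"
    using assms by (auto simp: full_chain_def under_def)
  show "a = fst m" if "a \<in> fst ` p \<and> (\<forall>x\<in>fst ` p. (x, a) \<in> S)" for a
    using that top finite_forest_antisym[OF S] by blast
qed

lemma proj2_bar_eq:
  assumes "full_chain S T p m"
  shows "proj2_bar T p = snd m"
  unfolding proj2_bar_def max_in_def
proof (rule the_equality)
  show top: "snd m \<in> snd ` p \<and> (\<forall>x\<in>snd ` p. (x, snd m) \<in> T)"
    using assms by (auto simp: full_chain_def under_def)
  show "b = snd m" if "b \<in> snd ` p \<and> (\<forall>x\<in>snd ` p. (x, b) \<in> T)" for b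
    using that top finite_forest_antisym[OF T] by blast
qed

lemma full_chain_projs:
  assumes "p \<in> Field (tensor S T)"
  shows "full_chain S T p (proj1_bar S p, proj2_bar T p)"
proof -
  obtain m where "full_chain S T p m"
    using assms unfolding Field_tensor tensor_carrier_iff ..
  then show ?thesis by (simp add: proj1_bar_eq proj2_bar_eq)
qed

lemma tensor_tops:
  assumes "(p, q) \<in> tensor S T"
  shows "((proj1_bar S p, proj2_bar T p), (proj1_bar S q, proj2_bar T q)) \<in> R"
  using assms
proof (rule tensorE)
  fix m n assume "full_chain S T p m" "full_chain S T q n" "m \<in> q"
  then show ?thesis
    by (simp add: proj1_bar_eq proj2_bar_eq) (simp add: full_chain_def)
qed

lemma forest_morphism_proj1: "forest_morphism (tensor S T) S (proj1_bar S)"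
proof (rule forest_morphismI)
  fix p assume p: "p \<in> Field (tensor S T)"
  show "proj1_bar S p \<in> Field S"
    using full_chain_projs[OF p] Field_R chain_subset_Field by (fastforce simp: full_chain_def)
  fix a assume "(a, proj1_bar S p) \<in> S"
  then have "a \<in> under S (proj1_bar S p)" by (simp add: under_def)
  also have "under S (proj1_bar S p) = fst ` p"
    using full_chain_projs[OF p] by (simp add: full_chain_def)
  finally obtain m where m: "m \<in> p" "fst m = a" by blast
  then show "\<exists>q. (q, p) \<in> tensor S T \<and> proj1_bar S q = a"
    using full_chain_truncate[OF full_chain_projs[OF p]] truncate_tensor[OF full_chain_projs[OF p]]
      proj1_bar_eq by blast
next
  fix p q assume "(p, q) \<in> tensor S T"
  then show "(proj1_bar S p, proj1_bar S q) \<in> S"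
    using tensor_tops by (auto simp: prod_poset_def)
qed

lemma forest_morphism_proj2: "forest_morphism (tensor S T) T (proj2_bar T)"
proof (rule forest_morphismI)
  fix p assume p: "p \<in> Field (tensor S T)"
  show "proj2_bar T p \<in> Field T"
    using full_chain_projs[OF p] Field_R chain_subset_Field by (fastforce simp: full_chain_def)
  fix b assume "(b, proj2_bar T p) \<in> T"
  then have "b \<in> under T (proj2_bar T p)" by (simp add: under_def)
  also have "under T (proj2_bar T p) = snd ` p"
    using full_chain_projs[OF p] by (simp add: full_chain_def)
  finally obtain m where m: "m \<in> p" "snd m = b" by blast
  then show "\<exists>q. (q, p) \<in> tensor S T \<and> proj2_bar T q = b"
    using full_chain_truncate[OF full_chain_projs[OF p]] truncate_tensor[OF full_chain_projs[OF p]]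
      proj2_bar_eq by blast
next
  fix p q assume "(p, q) \<in> tensor S T"
  then show "(proj2_bar T p, proj2_bar T q) \<in> T"
    using tensor_tops by (auto simp: prod_poset_def)
qed

end

section \<open>The universal property\<close>

definition mediating :: "'c rel \<Rightarrow> ('c \<Rightarrow> 'a) \<Rightarrow> ('c \<Rightarrow> 'b) \<Rightarrow> 'c \<Rightarrow> ('a \<times> 'b) set" where
  "mediating H f g x = (\<lambda>z. (f z, g z)) ` under H x"

locale forest_cone = forest_pair S T for S :: "'a rel" and T :: "'b rel" +
  fixes H :: "'c rel" and f :: "'c \<Rightarrow> 'a" and g :: "'c \<Rightarrow> 'b"
  assumes H: "finite_forest H" and f: "forest_morphism H S f" and g: "forest_morphism H T g"
begin

lemma pair_mono: "(z, w) \<in> H \<Longrightarrow> ((f z, g z), (f w, g w)) \<in> R"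
  using forest_morphism_mono[OF f] forest_morphism_mono[OF g] by (auto simp: prod_poset_def)

lemma full_chain_mediating:
  assumes x: "x \<in> Field H"
  shows "full_chain S T (mediating H f g x) (f x, g x)"
  unfolding full_chain_def
proof (intro conjI)
  show "mediating H f g x \<in> Chains R"
    using finite_forest_linear[OF H, of _ x] pair_mono
    by (fastforce simp: mediating_def Chains_def under_def)
  show "(f x, g x) \<in> mediating H f g x"
    using finite_forest_refl[OF H x] by (auto simp: mediating_def under_def)
  show "\<forall>y\<in>mediating H f g x. (y, (f x, g x)) \<in> R"
    using pair_mono by (auto simp: mediating_def under_def)
  show "fst ` mediating H f g x = under S (fst (f x, g x))"
    using forest_morphism_image_under[OF f x] by (simp add: mediating_def image_image)
  show "snd ` mediating H f g x = under T (snd (f x, g x))"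
    using forest_morphism_image_under[OF g x] by (simp add: mediating_def image_image)
qed

text \<open>The map \<open>z \<mapsto> (f z, g z)\<close> need not be injective on \<open>under H x\<close>. If \<open>w \<le> x\<close> has
  \<open>(f w, g w) \<le> (f z, g z)\<close> without \<open>w \<le> z\<close>, then \<open>z \<le> w\<close> by linearity and the two pairs are
  equal.\<close>

lemma mediating_truncate:
  assumes zx: "(z, x) \<in> H"
  shows "mediating H f g z = truncate R (mediating H f g x) (f z, g z)"
proof
  show "mediating H f g z \<subseteq> truncate R (mediating H f g x) (f z, g z)"
    using pair_mono finite_forest_trans[OF H _ zx]
    by (auto simp: mediating_def truncate_def under_def)
  show "truncate R (mediating H f g x) (f z, g z) \<subseteq> mediating H f g z"
  proof
    fix y assume "y \<in> truncate R (mediating H f g x) (f z, g z)"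
    then obtain w where w: "(w, x) \<in> H" "y = (f w, g w)" "(y, (f z, g z)) \<in> R"
      by (auto simp: mediating_def truncate_def under_def)
    consider "(w, z) \<in> H" | "(z, w) \<in> H" using finite_forest_linear[OF H w(1) zx] by blast
    then show "y \<in> mediating H f g z"
    proof cases
      case 1
      then show ?thesis using w by (auto simp: mediating_def under_def)
    next
      case 2
      then have "y = (f z, g z)" using R_antisym pair_mono w by blast
      moreover have "(z, z) \<in> H" using finite_forest_refl[OF H] FieldI1[OF zx] by blast
      ultimately show ?thesis by (auto simp: mediating_def under_def)
    qed
  qed
qed

lemma mediating_tensor:
  assumes zx: "(z, x) \<in> H"
  shows "(mediating H f g z, mediating H f g x) \<in> tensor S T"
proof -
  have "(f z, g z) \<in> mediating H f g x" using zx by (auto simp: mediating_def under_def)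
  then show ?thesis
    using truncate_tensor[OF full_chain_mediating] mediating_truncate[OF zx] FieldI2[OF zx] by metis
qed

lemma forest_morphism_mediating: "forest_morphism H (tensor S T) (mediating H f g)"
proof (rule forest_morphismI)
  fix x assume x: "x \<in> Field H"
  show "mediating H f g x \<in> Field (tensor S T)"
    using full_chain_in_Field full_chain_mediating[OF x] by blast
  fix p assume "(p, mediating H f g x) \<in> tensor S T"
  then obtain m where "m \<in> mediating H f g x" "p = truncate R (mediating H f g x) m"
    by (rule tensorE)
  then obtain z where "(z, x) \<in> H" "p = truncate R (mediating H f g x) (f z, g z)"
    by (auto simp: mediating_def under_def)
  then show "\<exists>z. (z, x) \<in> H \<and> mediating H f g z = p" using mediating_truncate by blast
qed (rule mediating_tensor)

lemma mediating_unique: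
  assumes h: "forest_morphism H (tensor S T) h"
    and h1: "\<And>x. x \<in> Field H \<Longrightarrow> proj1_bar S (h x) = f x"
    and h2: "\<And>x. x \<in> Field H \<Longrightarrow> proj2_bar T (h x) = g x"
    and x: "x \<in> Field H"
  shows "h x = mediating H f g x"
proof -
  have top: "full_chain S T (h z) (f z, g z)" if "z \<in> Field H" for z
    using full_chain_projs[OF forest_morphism_Field[OF h that]] h1 h2 that by simp
  \<comment> \<open>Openness of \<open>h\<close> realises the truncation of \<open>h x\<close> at \<open>m\<close> as some \<open>h z\<close>; comparing tops
    gives \<open>m = (f z, g z)\<close>.\<close>
  have "m \<in> mediating H f g x" if m: "m \<in> h x" for m
  proof -
    obtain z where z: "(z, x) \<in> H" "h z = truncate R (h x) m"
      using forest_morphism_open[OF h x truncate_tensor[OF top[OF x] m]] by blast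
    have "m = (f z, g z)"
      using full_chain_truncate[OF top[OF x] m] top[OF FieldI1[OF z(1)]] z(2)
        full_chain_top_unique by metis
    then show ?thesis using z by (auto simp: mediating_def under_def)
  qed
  moreover have "(f z, g z) \<in> h x" if "(z, x) \<in> H" for z
    using tensor_iff[OF top[OF FieldI1[OF that]]] forest_morphism_mono[OF h that] by blast
  ultimately show ?thesis by (auto simp: mediating_def under_def)
qed

end

theorem proposition29:
  fixes S :: "'a rel" and T :: "'b rel"
  assumes "finite_forest S" and "finite_forest T"
  shows "is_forest_product TYPE('c) S T (tensor S T) (proj1_bar S) (proj2_bar T)"
proof -
  interpret forest_pair S T using assms by unfold_locales
  have "\<exists>h. (forest_morphism H (tensor S T) h \<and>
          (\<forall>x\<in>Field H. proj1_bar S (h x) = f x) \<and> (\<forall>x\<in>Field H. proj2_bar T (h x) = g x)) \<and>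
        (\<forall>h'. forest_morphism H (tensor S T) h' \<and>
          (\<forall>x\<in>Field H. proj1_bar S (h' x) = f x) \<and> (\<forall>x\<in>Field H. proj2_bar T (h' x) = g x) \<longrightarrow>
          (\<forall>x\<in>Field H. h' x = h x))"
    if "finite_forest H" "forest_morphism H S f" "forest_morphism H T g"
    for H :: "'c rel" and f g
  proof -
    interpret forest_cone S T H f g using that by unfold_locales
    show ?thesis
    proof (intro exI[of _ "mediating H f g"] conjI allI impI)
      show "forest_morphism H (tensor S T) (mediating H f g)"
        by (rule forest_morphism_mediating)
      show "\<forall>x\<in>Field H. proj1_bar S (mediating H f g x) = f x"
        by (simp add: proj1_bar_eq[OF full_chain_mediating])
      show "\<forall>x\<in>Field H. proj2_bar T (mediating H f g x) = g x"
        by (simp add: proj2_bar_eq[OF full_chain_mediating])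
    qed (use mediating_unique in blast)
  qed
  then show ?thesis
    unfolding is_forest_product_def
    using finite_forest_tensor forest_morphism_proj1 forest_morphism_proj2 by blast
qed

end
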